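(* The triangle inequalities do not remain valid for translation triangles in $\mathbf{Sol}$ in general. That is, there exist points $A_1,A_2,A_3\in\mathbf{Sol}$, the vertices of a translation triangle, such that $$d^t(A_1,A_2)+d^t(A_1,A_3)<d^t(A_2,A_3).$$
   Context: $\mathbf{Sol}$ is $\mathbb{R}^3$ with the group multiplication $(a,b,c)(x,y,z)=(x+ae^{-z},\,y+be^{z},\,z+c)$ and the Riemannian metric $ds^2=e^{2z}dx^2+e^{-2z}dy^2+dz^2$. For $P=(x,y,z)$ the translation $\tau_P$ is the map $(a,b,c)\mapsto (a,b,c)(x,y,z)=(x+ae^{-z},\,y+be^{z},\,z+c)$; it is an isometry taking the origin $O=(0,0,0)$ to $P$. Translation curves starting at the origin with initial tangent vector $(u,v,w)$ are the solutions of $\dot x=ue^{-z}$, $\dot y=ve^{z}$, $\dot z=w$, $x(0)=y(0)=z(0)=0$, i.e. $x(t)=-\frac{u}{w}(e^{-wt}-1)$, $y(t)=\frac{v}{w}(e^{wt}-1)$, $z(t)=wt$ if $w\neq0$, and $x(t)=ut$, $y(t)=vt$, $z(t)=0$ if $w=0$. Translation curves starting at an arbitrary point $P$ are the images under $\tau_P$ of translation curves starting at $O$. Between any two distinct points $P_1,P_2$ there is a unique translation curve segment starting at $P_1$ and ending at $P_2$ (up to parametrization); the translation distance $d^t(P_1,P_2)$ is its arc length with respect to the metric above (and $d^t(P,P)=0$). A translation triangle $A_1A_2A_3$ is given by three points $A_1,A_2,A_3$ of $\mathbf{Sol}$ (its vertices); its sides are the translation curve segments connecting the vertices, and the length of the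 side $A_iA_j$ is $d^t(A_i,A_j)$. *)

theory Defs
  imports "HOL-Analysis.Analysis"
begin

text \<open>Both points of Sol and tangent vectors are given by their three real coordinates.\<close>

type_synonym sol = "real \<times> real \<times> real"

fun sol_mult :: "sol \<Rightarrow> sol \<Rightarrow> sol" where
  "sol_mult (a, b, c) (x, y, z) = (x + a * exp (- z), y + b * exp z, z + c)"

text \<open>The translation by \<^term>\<open>P\<close> is multiplication by \<^term>\<open>P\<close> from the \<^emph>\<open>right\<close>.\<close>

definition sol_trans :: "sol \<Rightarrow> sol \<Rightarrow> sol" where
  "sol_trans P A = sol_mult A P"

fun sol_metric :: "sol \<Rightarrow> sol \<Rightarrow> sol \<Rightarrow> real" where
  "sol_metric (x, y, z) (X1, X2, X3) (Y1, Y2, Y3) =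
     exp (2 * z) * X1 * Y1 + exp (- 2 * z) * X2 * Y2 + X3 * Y3"

definition sol_length :: "(real \<Rightarrow> sol) \<Rightarrow> real \<Rightarrow> real \<Rightarrow> real" where
  "sol_length \<gamma> a b = integral {a..b}
     (\<lambda>t. sqrt (sol_metric (\<gamma> t) (vector_derivative \<gamma> (at t)) (vector_derivative \<gamma> (at t))))"

fun translation_field :: "sol \<Rightarrow> sol \<Rightarrow> sol" where
  "translation_field (u, v, w) (x, y, z) = (u * exp (- z), v * exp z, w)"

definition origin_translation_curve :: "sol \<Rightarrow> (real \<Rightarrow> sol) \<Rightarrow> bool" where
  "origin_translation_curve V \<gamma> \<longleftrightarrow>
     \<gamma> 0 = (0, 0, 0) \<and>
     (\<forall>t. (\<gamma> has_vector_derivative translation_field V (\<gamma> t)) (at t))"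

definition translation_curve_from :: "sol \<Rightarrow> (real \<Rightarrow> sol) \<Rightarrow> bool" where
  "translation_curve_from P \<gamma> \<longleftrightarrow>
     (\<exists>V \<gamma>0. origin_translation_curve V \<gamma>0 \<and> \<gamma> = (\<lambda>t. sol_trans P (\<gamma>0 t)))"

text \<open>
  For \<^prop>\<open>P \<noteq> Q\<close> the translation curve segment from \<^term>\<open>P\<close> to \<^term>\<open>Q\<close> exists and is unique up
  to rescaling the parameter. The rescaling does not affect the length, so the definite
  description denotes the length of that segment.
\<close>

definition translation_dist :: "sol \<Rightarrow> sol \<Rightarrow> real" where
  "translation_dist P Q =
     (if P = Q then 0
      else THE l. \<exists>\<gamma> T. translation_curve_from P \<gamma> \<and> 0 \<le> T \<and> \<gamma> T = Q \<and> l = sol_length \<gamma> 0 T)"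

end

theory Submission
  imports Defs
begin

text \<open>
  The translation curve with initial vector \<open>V\<close> is \<open>t \<mapsto> sol_exp (t V)\<close> for an injective
  map \<open>sol_exp\<close>. Its speed is constantly \<open>\<parallel>V\<parallel>\<close>, and right translations are isometries, so
  \<open>d(P, \<tau>\<^sub>P (sol_exp V)) = \<parallel>V\<parallel>\<close>. Between two points of equal height \<open>z\<close> the translation curve
  stays at that height and has length \<open>e\<^sup>z \<bar>\<Delta>x\<bar>\<close> if \<open>y\<close> is constant, whereas a detour through a
  lower point is shorter: from \<open>(1, 0, ln 2)\<close> to \<open>(-1, 0, ln 2)\<close> the distance is \<open>4\<close>, but each of
  the two points has only distance \<open>\<surd>5 ln 2 < 2\<close> from the origin.
\<close>

text \<open>This is \<open>(e^w - 1) / w\<close> with its removable singularity at \<open>0\<close>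
  filled in, so that one formula covers translation curves with \<open>w = 0\<close> and with
  \<open>w \<noteq> 0\<close>.\<close>

definition exp_quot :: "real \<Rightarrow> real" where
  "exp_quot w = (if w = 0 then 1 else (exp w - 1) / w)"

lemma exp_quot_0 [simp]: "exp_quot 0 = 1"
  by (simp add: exp_quot_def)

lemma exp_quot_nonzero [simp]: "exp_quot w \<noteq> 0"
  by (simp add: exp_quot_def)

text \<open>The function \<open>t * exp_quot (t * w)\<close> is the integral of
  \<open>exp (s * w)\<close> over \<open>s\<close> from \<open>0\<close> to \<open>t\<close>; the
  \<open>x\<close> and \<open>y\<close> coordinates of a translation curve from the origin are
  multiples of such integrals.\<close>

lemma has_real_derivative_exp_quot:
  "((\<lambda>t. t * exp_quot (t * w)) has_real_derivative exp (t * w)) (at t)"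
proof (cases "w = 0")
  case False
  have "(\<lambda>t. t * exp_quot (t * w)) = (\<lambda>t. (exp (t * w) - 1) / w)"
    using False by (auto simp: exp_quot_def)
  then show ?thesis
    using False by (auto intro!: derivative_eq_intros)
qed simp

fun sol_exp :: "sol \<Rightarrow> sol" where
  "sol_exp (u, v, w) = (u * exp_quot (- w), v * exp_quot w, w)"

text \<open>The third coordinate returns \<open>w\<close>; the nonzero factors
  \<open>exp_quot (- w)\<close> and \<open>exp_quot w\<close> can then be cancelled.\<close>

lemma inj_sol_exp: "inj sol_exp"
  by (auto simp: inj_def)

lemma sol_exp_0 [simp]: "sol_exp 0 = 0"
  by (simp add: zero_prod_def)

lemma inj_sol_trans: "inj (sol_trans P)"
  by (cases P) (auto simp: inj_def sol_trans_def)

lemma sol_trans_0 [simp]: "sol_trans P 0 = P"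
  by (cases P) (simp add: sol_trans_def zero_prod_def)

lemma origin_translation_curve_sol_exp:
  "origin_translation_curve V (\<lambda>t. sol_exp (t *\<^sub>R V))"
proof -
  obtain u v w where V: "V = (u, v, w)" by (cases V)
  have "((\<lambda>t. (u * (t * exp_quot (t * - w)), v * (t * exp_quot (t * w)), t * w))
          has_vector_derivative (u * exp (t * - w), v * exp (t * w), w)) (at t)" for t
    by (intro has_vector_derivative_Pair
          DERIV_cmult[OF has_real_derivative_exp_quot,
            unfolded has_real_derivative_iff_has_vector_derivative])
      (auto intro!: derivative_eq_intros)
  then show ?thesis
    unfolding V origin_translation_curve_def by (simp add: mult_ac)
qed

lemma has_real_derivative_unique:
  fixes f g :: "real \<Rightarrow> real"
  assumes "\<And>t. (f has_real_derivative h t) (at t)" "\<And>t. (g has_real_derivative h t) (at t)"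
    and "f a = g a"
  shows "f t = g t"
proof -
  have "((\<lambda>t. f t - g t) has_real_derivative 0) (at t)" for t
    using DERIV_diff[OF assms(1,2)] by simp
  then have "f t - g t = f a - g a"
    by (intro DERIV_isconst_all) auto
  then show ?thesis using assms(3) by simp
qed

lemma has_vector_derivative_coords:
  fixes f :: "real \<Rightarrow> sol"
  assumes "(f has_vector_derivative (x, y, z)) (at t)"
  shows "((\<lambda>t. fst (f t)) has_real_derivative x) (at t)"
    and "((\<lambda>t. fst (snd (f t))) has_real_derivative y) (at t)"
    and "((\<lambda>t. snd (snd (f t))) has_real_derivative z) (at t)"
  using assms
    bounded_linear.has_vector_derivative[OF bounded_linear_fst]
    bounded_linear.has_vector_derivative[OF bounded_linear_snd]
  unfolding has_real_derivative_iff_has_vector_derivative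
  by (metis fst_conv snd_conv)+

text \<open>The system is triangular: \<open>z\<close> has constant derivative \<open>w\<close>, so
  the heights agree first. Then the derivatives of \<open>x\<close> and \<open>y\<close> are the
  same functions of \<open>t\<close> for both curves, and no general ODE theorem is
  required.\<close>

lemma origin_translation_curve_unique:
  assumes "origin_translation_curve V \<gamma>" "origin_translation_curve V \<delta>"
  shows "\<gamma> = \<delta>"
proof
  fix t
  obtain u v w where V: "V = (u, v, w)" by (cases V)
  have d: "(f has_vector_derivative
      (u * exp (- snd (snd (f t))), v * exp (snd (snd (f t))), w)) (at t)"
    and i: "f 0 = (0, 0, 0)"
    if "origin_translation_curve V f" for f t
    using that unfolding V origin_translation_curve_def
    by (metis translation_field.simps prod.collapse, metis)
  note dx = has_vector_derivative_coords(1)[OF d]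
    and dy = has_vector_derivative_coords(2)[OF d]
    and dz = has_vector_derivative_coords(3)[OF d]
  have z: "snd (snd (\<gamma> t)) = snd (snd (\<delta> t))" for t
    by (rule has_real_derivative_unique[OF dz dz, where a = 0])
      (simp_all add: assms i[OF assms(1)] i[OF assms(2)])
  have "fst (\<gamma> t) = fst (\<delta> t)"
    by (rule has_real_derivative_unique[OF dx dx[OF assms(2), folded z], where a = 0])
      (simp_all add: assms i[OF assms(1)] i[OF assms(2)])
  moreover have "fst (snd (\<gamma> t)) = fst (snd (\<delta> t))"
    by (rule has_real_derivative_unique[OF dy dy[OF assms(2), folded z], where a = 0])
      (simp_all add: assms i[OF assms(1)] i[OF assms(2)])
  ultimately show "\<gamma> t = \<delta> t"
    using z by (simp add: prod_eq_iff)
qed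

text \<open>At height \<open>r + z\<close> the velocity components carry the factors
  \<open>exp (- (r + z))\<close> and \<open>exp (r + z)\<close>, which the metric coefficients
  cancel exactly. The speed is thus constant.\<close>

lemma sol_length_translation_curve:
  assumes "origin_translation_curve V \<gamma>" "0 \<le> T"
  shows "sol_length (\<lambda>t. sol_trans P (\<gamma> t)) 0 T = T * norm V"
proof -
  obtain u v w where V: "V = (u, v, w)" by (cases V)
  obtain p q r where P: "P = (p, q, r)" by (cases P)
  have "sqrt (sol_metric (sol_trans P (\<gamma> t))
      (vector_derivative (\<lambda>t. sol_trans P (\<gamma> t)) (at t))
      (vector_derivative (\<lambda>t. sol_trans P (\<gamma> t)) (at t))) = norm V" for t
  proof -
    obtain x y z where g: "\<gamma> t = (x, y, z)" by (cases "\<gamma> t")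
    have "(\<gamma> has_vector_derivative (u * exp (- z), v * exp z, w)) (at t)"
      using assms(1) g unfolding V origin_translation_curve_def
      by (metis translation_field.simps)
    note d = has_vector_derivative_coords[OF this]
    have trans: "sol_trans P (\<gamma> t) =
        (p + fst (\<gamma> t) * exp (- r), q + fst (snd (\<gamma> t)) * exp r, r + snd (snd (\<gamma> t)))" for t
      by (cases "\<gamma> t") (simp add: sol_trans_def P)
    have "((\<lambda>t. sol_trans P (\<gamma> t)) has_vector_derivative
        (u * exp (- z) * exp (- r), v * exp z * exp r, w)) (at t)"
      unfolding trans
      by (intro has_vector_derivative_Pair)
        (use d in \<open>auto intro!: derivative_eq_intros
          simp flip: has_real_derivative_iff_has_vector_derivative\<close>)
    then have "vector_derivative (\<lambda>t. sol_trans P (\<gamma> t)) (at t) =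
        (u * exp (- (r + z)), v * exp (r + z), w)" (is "_ = ?D")
      by (simp add: vector_derivative_at mult.assoc add.commute flip: exp_add)
    moreover have "sol_metric (sol_trans P (\<gamma> t)) ?D ?D = u\<^sup>2 + v\<^sup>2 + w\<^sup>2"
    proof -
      have sq: "exp (2 * s) * (k * exp (- s)) * (k * exp (- s)) = k\<^sup>2" for s k :: real
        unfolding exp_double by (simp add: exp_minus field_simps power2_eq_square)
      have sq': "exp (- 2 * s) * (k * exp s) * (k * exp s) = k\<^sup>2" for s k :: real
        using sq[of "- s" k] by simp
      have "sol_trans P (\<gamma> t) = (p + x * exp (- r), q + y * exp r, r + z)"
        by (simp add: sol_trans_def P g)
      then show ?thesis
        by (simp only: sol_metric.simps sq sq' power2_eq_square[of w])
    qed
    ultimately show ?thesis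
      by (simp add: V norm_Pair)
  qed
  then show ?thesis
    using assms(2) by (simp add: sol_length_def)
qed

lemma translation_dist_sol_exp:
  "translation_dist P (sol_trans P (sol_exp V)) = norm V"
proof (cases "V = 0")
  case False
  let ?Q = "sol_trans P (sol_exp V)"
  have "P \<noteq> ?Q"
    using False by (metis injD inj_sol_exp inj_sol_trans sol_exp_0 sol_trans_0)
  moreover have "(THE l. \<exists>\<gamma> T. translation_curve_from P \<gamma> \<and> 0 \<le> T \<and> \<gamma> T = ?Q
      \<and> l = sol_length \<gamma> 0 T) = norm V"
  proof (rule the_equality)
    note c = origin_translation_curve_sol_exp[of V]
    show "\<exists>\<gamma> T. translation_curve_from P \<gamma> \<and> 0 \<le> T \<and> \<gamma> T = ?Q \<and> norm V = sol_length \<gamma> 0 T"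
      by (rule exI[of _ "\<lambda>t. sol_trans P (sol_exp (t *\<^sub>R V))"], rule exI[of _ 1])
        (use c sol_length_translation_curve[OF c, of 1 P] in
          \<open>force simp: translation_curve_from_def simp del: sol_exp.simps split_paired_Ex\<close>)
  next
    fix l
    assume "\<exists>\<gamma> T. translation_curve_from P \<gamma> \<and> 0 \<le> T \<and> \<gamma> T = ?Q \<and> l = sol_length \<gamma> 0 T"
    then obtain W \<gamma> T where \<gamma>: "origin_translation_curve W \<gamma>" "0 \<le> T"
      and end_pt: "sol_trans P (\<gamma> T) = ?Q"
      and l: "l = sol_length (\<lambda>t. sol_trans P (\<gamma> t)) 0 T"
      unfolding translation_curve_from_def by auto
    have "\<gamma> T = sol_exp (T *\<^sub>R W)"
      using origin_translation_curve_unique[OF \<gamma>(1) origin_translation_curve_sol_exp] by simp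
    \<comment> \<open>Only the product of time and initial vector is determined by the endpoint, but
      the length \<open>T * norm W\<close> depends on nothing else.\<close>
    with end_pt have "T *\<^sub>R W = V"
      by (metis injD inj_sol_exp inj_sol_trans)
    with \<gamma>(2) have "T * norm W = norm V"
      by auto
    then show "l = norm V"
      using sol_length_translation_curve[OF \<gamma>] l by simp
  qed
  ultimately show ?thesis
    by (simp add: translation_dist_def)
qed (simp add: translation_dist_def)

theorem lemma3p5:
  "\<exists>A1 A2 A3 :: sol.
     translation_dist A1 A2 + translation_dist A1 A3 < translation_dist A2 A3"
proof -
  let ?c = "ln 2 :: real"
  \<comment> \<open>Since \<open>exp_quot (- ln 2) = 1 / (2 * ln 2)\<close>, the first component
    \<open>2 * ln 2\<close> yields \<open>x = 1\<close>.\<close>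
  have "sol_exp (2 * ?c, 0, ?c) = (1, 0, ?c)" "sol_exp (- 2 * ?c, 0, ?c) = (-1, 0, ?c)"
    by (simp_all add: exp_quot_def exp_minus)
  then have "translation_dist 0 (1, 0, ?c) = norm (2 * ?c, 0 :: real, ?c)"
    and "translation_dist 0 (-1, 0, ?c) = norm (- 2 * ?c, 0 :: real, ?c)"
    using translation_dist_sol_exp[of 0 "(2 * ?c, 0, ?c)"]
      translation_dist_sol_exp[of 0 "(- 2 * ?c, 0, ?c)"]
    by (simp_all add: sol_trans_def zero_prod_def)
  \<comment> \<open>The sign \<open>s\<close> treats both vectors at once; the squared norm is
    \<open>5 * (ln 2)^2\<close>, at most \<open>3125 / 1296 < 4\<close>.\<close>
  moreover have "norm (s * 2 * ?c, 0 :: real, ?c) < 2" if "s\<^sup>2 = 1" for s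
  proof -
    have "?c\<^sup>2 \<le> (25 / 36)\<^sup>2"
      by (intro power_mono ln2_le_25_over_36) simp
    then have "(s * 2 * ?c)\<^sup>2 + ?c\<^sup>2 < 2\<^sup>2"
      unfolding power_mult_distrib that by (simp add: power2_eq_square)
    then show ?thesis
      unfolding norm_Pair by (intro real_less_lsqrt) auto
  qed
  from this[of 1] this[of "- 1"]
  have "norm (2 * ?c, 0 :: real, ?c) < 2" "norm (- 2 * ?c, 0 :: real, ?c) < 2"
    by simp_all
  \<comment> \<open>Translation to height \<open>ln 2\<close> halves \<open>x\<close>-displacements,
    so the displacement \<open>-2\<close> comes from \<open>-4\<close>; with \<open>w = 0\<close>,
    \<open>sol_exp\<close> fixes this vector.\<close>
  moreover have "translation_dist (1, 0, ?c) (-1, 0, ?c) = 4"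
    using translation_dist_sol_exp[of "(1, 0, ?c)" "(- 4, 0, 0)"]
    by (simp add: sol_trans_def exp_minus norm_Pair)
  ultimately have "translation_dist 0 (1, 0, ?c) + translation_dist 0 (-1, 0, ?c)
      < translation_dist (1, 0, ?c) (-1, 0, ?c)"
    by linarith
  then show ?thesis by blast
qed

end
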